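(* Let $f : X \to Y$ be a simplicial map of simplicial complexes with $m = \dim Y$ finite, and let $(E^r, d^r, \xi^r)_{r\ge 0}$ be its Leray spectral sequence over a field $k$. Then for every integer $n \ge 0$ there is a canonical isomorphism of $k$-vector spaces $$H_n(X) \cong \bigoplus_{p=0}^n E^{m+1}_{p,\,n-p}.$$
   Context: Fix a field $k$; $H_n(X)$ denotes simplicial homology of $X$ with coefficients in $k$. Let $f : X \to Y$ be a simplicial map. $C_d(X)$ is the $k$-vector space of simplicial $d$-chains of $X$ (finite formal sums of oriented $d$-simplices; zero for $d<0$), with the usual simplicial boundary $\partial$. $Y^j$ is the $j$-skeleton of $Y$ (empty for $j<0$). For integers $p,q$, $X_{p,q}\subseteq C_{p+q}(X)$ is the subspace spanned by the $(p+q)$-simplices $\sigma$ of $X$ with $f(\sigma)\in Y^p$. For any integer $r$ put $$B^r_{p,q}=X_{p,q}\cap\partial(X_{p+r,q-r+1}),\qquad Z^r_{p,q}=X_{p,q}\cap\partial^{-1}(X_{p-r,q+r-1}),$$ both subspaces of $C_{p+q}(X)$. The Leray spectral sequence $(E^r,d^r,\xi^r)_{r\ge0}$ of $f$ has, for $r\ge 0$, $$E^r_{p,q}=\frac{Z^r_{p,q}}{Z^{r-1}_{p-1,q+1}+B^{r-1}_{p,q}},\qquad E^r=\bigoplus_{p,q}E^r_{p,q};$$ the map $d^r_{p,q}:E^r_{p,q}\to E^r_{p-r,q+r-1}$ is induced by $\partial$, $d^r=\bigoplus_{p,q} d^r_{p,q}$, and $\xi^r$ is the resulting isomorphism $\ker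 d^r/\mathrm{im}\, d^r\cong E^{r+1}$. *)

theory Defs
  imports
    Complex_Main
    "HOL-Combinatorics.Permutations"
    "HOL-Library.FuncSet"
    "HOL-Library.Function_Algebras"
    "HOL-Library.Set_Algebras"
begin

section \<open>Simplicial complexes\<close>

text \<open>A complex is represented by its set of (nonempty) simplices; it may be infinite, and the
  empty complex is allowed.\<close>

definition simplicial_complex :: "'v set set \<Rightarrow> bool" where
  "simplicial_complex K \<longleftrightarrow>
    (\<forall>\<sigma>\<in>K. finite \<sigma> \<and> \<sigma> \<noteq> {}) \<and> (\<forall>\<sigma>\<in>K. \<forall>\<tau>. \<tau> \<noteq> {} \<and> \<tau> \<subseteq> \<sigma> \<longrightarrow> \<tau> \<in> K)"

definition simplex_dim :: "'v set \<Rightarrow> int" where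
  "simplex_dim \<sigma> = int (card \<sigma>) - 1"

definition finite_dimensional :: "'v set set \<Rightarrow> bool" where
  "finite_dimensional K \<longleftrightarrow> (\<exists>d. \<forall>\<sigma>\<in>K. simplex_dim \<sigma> \<le> d)"

text \<open>Meaningful for finite-dimensional complexes only.\<close>

definition complex_dim :: "'v set set \<Rightarrow> int" where
  "complex_dim K = (if K = {} then -1 else Max (simplex_dim ` K))"

definition skeleton :: "'v set set \<Rightarrow> int \<Rightarrow> 'v set set" where
  "skeleton K j = {\<sigma> \<in> K. simplex_dim \<sigma> \<le> j}"

text \<open>A simplicial map is given by its vertex map; values of \<open>f\<close> outside the vertex set of \<open>X\<close>
  are irrelevant.\<close>

definition simplicial_map :: "'v set set \<Rightarrow> 'w set set \<Rightarrow> ('v \<Rightarrow> 'w) \<Rightarrow> bool" where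
  "simplicial_map X Y f \<longleftrightarrow> (\<forall>\<sigma>\<in>X. f ` \<sigma> \<in> Y)"


section \<open>Subquotients of a function space and their direct sums\<close>

definition fscale :: "'k::field \<Rightarrow> ('i \<Rightarrow> 'k) \<Rightarrow> ('i \<Rightarrow> 'k)" where
  "fscale a c = (\<lambda>i. a * c i)"

global_interpretation fun_vs: vector_space fscale
  by unfold_locales (auto simp: fscale_def fun_eq_iff algebra_simps)

record ('k, 'a) vspace =
  carrier :: "'a set"
  vadd :: "'a \<Rightarrow> 'a \<Rightarrow> 'a"
  vscale :: "'k \<Rightarrow> 'a \<Rightarrow> 'a"

text \<open>The quotient of \<open>V\<close> by a subspace \<open>W \<subseteq> V\<close>: its elements are the cosets of \<open>W\<close>.
  Adding \<open>W\<close> in the scalar multiplication only matters for the scalar \<open>0\<close>.\<close>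

definition quotient_space ::
    "('i \<Rightarrow> 'k::field) set \<Rightarrow> ('i \<Rightarrow> 'k) set \<Rightarrow> ('k, ('i \<Rightarrow> 'k) set) vspace" where
  "quotient_space V W =
    \<lparr>carrier = (\<lambda>v. v +o W) ` V,
     vadd = (\<lambda>A B. A + B),
     vscale = (\<lambda>a A. fscale a ` A + W)\<rparr>"

lemma quotient_space_vadd:
  assumes "fun_vs.subspace W"
  shows "vadd (quotient_space V W) (v +o W) (w +o W) = (v + w) +o W"
proof -
  have "W + W = W"
  proof (intro equalityI subsetI)
    fix x assume "x \<in> W"
    then show "x \<in> W + W"
      using set_plus_intro[OF _ fun_vs.subspace_0[OF assms]] by force
  qed (use fun_vs.subspace_add[OF assms] in \<open>auto simp: set_plus_def\<close>)
  then show ?thesis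
    by (simp add: quotient_space_def set_plus_rearrange)
qed

lemma quotient_space_vscale:
  assumes "fun_vs.subspace W"
  shows "vscale (quotient_space V W) a (v +o W) = fscale a v +o W"
proof -
  have "fscale a ` (v +o W) + W = fscale a v +o W"
  proof (intro equalityI subsetI)
    fix x assume "x \<in> fscale a ` (v +o W) + W"
    then obtain w w' where w: "w \<in> W" "w' \<in> W" "x = fscale a (v + w) + w'"
      by (auto simp: elt_set_plus_def set_plus_def)
    then have "x = fscale a v + (fscale a w + w')"
      by (simp add: fun_vs.scale_right_distrib add.assoc)
    moreover have "fscale a w + w' \<in> W"
      using w assms by (simp add: fun_vs.subspace_add fun_vs.subspace_scale)
    ultimately show "x \<in> fscale a v +o W"
      by (metis set_plus_intro2)
  next
    fix x assume "x \<in> fscale a v +o W"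
    then obtain w where w: "w \<in> W" "x = fscale a v + w"
      by (auto simp: elt_set_plus_def)
    have "v + 0 \<in> v +o W"
      using fun_vs.subspace_0[OF assms] by (rule set_plus_intro2)
    then have "fscale a v \<in> fscale a ` (v +o W)"
      by (metis add.right_neutral imageI)
    with w show "x \<in> fscale a ` (v +o W) + W"
      by (metis set_plus_intro)
  qed
  then show ?thesis by (simp add: quotient_space_def)
qed

text \<open>For finite index sets only, where direct sum and direct product agree.\<close>

definition direct_sum :: "'j set \<Rightarrow> ('j \<Rightarrow> ('k, 'a) vspace) \<Rightarrow> ('k, 'j \<Rightarrow> 'a) vspace" where
  "direct_sum J V =
    \<lparr>carrier = (\<Pi>\<^sub>E j\<in>J. carrier (V j)),
     vadd = (\<lambda>x y. \<lambda>j\<in>J. vadd (V j) (x j) (y j)),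
     vscale = (\<lambda>a x. \<lambda>j\<in>J. vscale (V j) a (x j))\<rparr>"

definition vspace_iso :: "('k, 'a) vspace \<Rightarrow> ('k, 'b) vspace \<Rightarrow> ('a \<Rightarrow> 'b) \<Rightarrow> bool" where
  "vspace_iso V W \<phi> \<longleftrightarrow>
    bij_betw \<phi> (carrier V) (carrier W) \<and>
    (\<forall>x\<in>carrier V. \<forall>y\<in>carrier V. \<phi> (vadd V x y) = vadd W (\<phi> x) (\<phi> y)) \<and>
    (\<forall>a. \<forall>x\<in>carrier V. \<phi> (vscale V a x) = vscale W a (\<phi> x))"


section \<open>Oriented simplicial chains\<close>

text \<open>A chain assigns a coefficient to every ordering of every simplex, with sign changes under
  odd permutations. The oriented simplex \<open>[v\<^sub>0,\<dots>,v\<^sub>d]\<close> (with distinct vertices) is the chain with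
  value \<open>sign \<pi>\<close> at \<open>(\<pi> v\<^sub>0,\<dots>,\<pi> v\<^sub>d)\<close> for each permutation \<open>\<pi>\<close> of its vertices; at every list
  the sum below has at most one summand.\<close>

definition oriented_simplex :: "'v list \<Rightarrow> ('v list \<Rightarrow> 'k::field)" where
  "oriented_simplex vs = (\<lambda>ws. \<Sum>\<pi> | \<pi> permutes set vs \<and> map \<pi> vs = ws. of_int (sign \<pi>))"

definition chains :: "'v set set \<Rightarrow> int \<Rightarrow> ('v list \<Rightarrow> 'k::field) set" where
  "chains K d = fun_vs.span
    {oriented_simplex vs | vs. distinct vs \<and> set vs \<in> K \<and> simplex_dim (set vs) = d}"

text \<open>Evaluated at \<open>(w\<^sub>0,\<dots>,w\<^sub>d)\<close>, the boundary of \<open>c\<close> collects the coefficients of the orderings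
  \<open>(v,w\<^sub>0,\<dots>,w\<^sub>d)\<close>. The usual formula is \<open>boundary_oriented_simplex\<close> below. There is no
  augmentation: the boundary of a \<open>0\<close>-chain is \<open>0\<close>. The map is linear only on chains (which have
  finite support), see \<open>boundary_add\<close> and \<open>boundary_fscale\<close>.\<close>

definition boundary :: "('v list \<Rightarrow> 'k::field) \<Rightarrow> ('v list \<Rightarrow> 'k)" where
  "boundary c = (\<lambda>ws. if ws = [] then 0 else \<Sum>v | c (v # ws) \<noteq> 0. c (v # ws))"

lemma oriented_simplex_permute:
  assumes "\<pi> permutes set vs"
  shows "(oriented_simplex (map \<pi> vs) :: 'v list \<Rightarrow> 'k::field) = fscale (of_int (sign \<pi>)) (oriented_simplex vs)"
proof
  fix ws
  have perm: "permutation \<pi>"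
    using assms permutation_permutes by blast
  have s: "set (map \<pi> vs) = set vs"
    using permutes_image[OF assms] by simp
  have "(oriented_simplex (map \<pi> vs) :: 'v list \<Rightarrow> 'k) ws
      = (\<Sum>\<rho> | \<rho> permutes set vs \<and> map \<rho> vs = ws. of_int (sign \<pi>) * of_int (sign \<rho>) :: 'k)"
    unfolding oriented_simplex_def s
  proof (rule sum.reindex_bij_witness[where i="\<lambda>\<rho>. \<rho> \<circ> inv \<pi>" and j="\<lambda>\<rho>. \<rho> \<circ> \<pi>"])
    fix \<rho> assume "\<rho> \<in> {\<rho>. \<rho> permutes set vs \<and> map \<rho> (map \<pi> vs) = ws}"
    then have \<rho>: "\<rho> permutes set vs" "map \<rho> (map \<pi> vs) = ws" by auto
    show "\<rho> \<circ> \<pi> \<circ> inv \<pi> = \<rho>"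
      by (simp add: o_assoc[symmetric] permutes_inv_o(1)[OF assms])
    show "\<rho> \<circ> \<pi> \<in> {\<rho>. \<rho> permutes set vs \<and> map \<rho> vs = ws}"
      using \<rho> assms by (simp add: permutes_compose)
    have "permutation \<rho>"
      using \<rho> permutation_permutes by blast
    then have "sign \<pi> * sign (\<rho> \<circ> \<pi>) = sign \<rho> * (sign \<pi> * sign \<pi>)"
      using perm by (simp add: sign_compose)
    also have "\<dots> = sign \<rho>" by (simp add: sign_idempotent)
    finally show "of_int (sign \<pi>) * of_int (sign (\<rho> \<circ> \<pi>)) = (of_int (sign \<rho>) :: 'k)"
      by (metis of_int_mult)
  next
    fix \<rho> assume "\<rho> \<in> {\<rho>. \<rho> permutes set vs \<and> map \<rho> vs = ws}"
    then have \<rho>: "\<rho> permutes set vs" "map \<rho> vs = ws" by auto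
    show "\<rho> \<circ> inv \<pi> \<circ> \<pi> = \<rho>"
      by (simp add: o_assoc[symmetric] permutes_inv_o(2)[OF assms])
    show "\<rho> \<circ> inv \<pi> \<in> {\<rho>. \<rho> permutes set vs \<and> map \<rho> (map \<pi> vs) = ws}"
      using \<rho> assms by (auto simp: permutes_compose permutes_inv permutes_inverses)
  qed
  also have "\<dots> = fscale (of_int (sign \<pi>)) (oriented_simplex vs) ws"
    by (simp add: fscale_def oriented_simplex_def sum_distrib_left)
  finally show "(oriented_simplex (map \<pi> vs) :: 'v list \<Rightarrow> 'k) ws
      = fscale (of_int (sign \<pi>)) (oriented_simplex vs) ws" .
qed

lemma oriented_simplex_self:
  shows "oriented_simplex vs vs = 1"
proof -
  have "{\<pi>. \<pi> permutes set vs \<and> map \<pi> vs = vs} = {id}"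
  proof (intro equalityI subsetI)
    fix \<pi> assume \<pi>: "\<pi> \<in> {\<pi>. \<pi> permutes set vs \<and> map \<pi> vs = vs}"
    have "\<pi> x = x" for x
    proof (cases "x \<in> set vs")
      case True
      have "map \<pi> vs = map id vs" using \<pi> by simp
      with True show ?thesis unfolding map_eq_conv by simp
    next
      case False
      with \<pi> show ?thesis using permutes_not_in[of \<pi> "set vs" x] by simp
    qed
    then show "\<pi> \<in> {id}" by (simp add: fun_eq_iff)
  qed (simp add: permutes_id)
  then show ?thesis by (simp add: oriented_simplex_def)
qed

lemma oriented_simplex_nonzero:
  assumes "oriented_simplex vs ws \<noteq> (0 :: 'k::field)"
  shows "set ws = set vs \<and> length ws = length vs"
proof -
  have "{\<pi>. \<pi> permutes set vs \<and> map \<pi> vs = ws} \<noteq> {}"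
    using assms unfolding oriented_simplex_def by (metis sum.empty)
  then obtain \<pi> where "\<pi> permutes set vs" "map \<pi> vs = ws" by auto
  then show ?thesis using permutes_image[of \<pi> "set vs"] by auto
qed

lemma finite_support_oriented_simplex:
  "finite {ws. oriented_simplex vs ws \<noteq> (0 :: 'k::field)}"
proof (rule finite_subset)
  show "{ws. oriented_simplex vs ws \<noteq> (0::'k)} \<subseteq> {ws. set ws \<subseteq> set vs \<and> length ws = length vs}"
    using oriented_simplex_nonzero by blast
qed (simp add: finite_lists_length_eq)

lemma finite_support_chains:
  assumes "c \<in> chains K d"
  shows "finite {ws. c ws \<noteq> 0}"
  using assms unfolding chains_def
proof (induction rule: fun_vs.span_induct_alt)
  case base
  then show ?case by simp
next
  case (step a x y)
  then obtain vs where x: "x = oriented_simplex vs" by auto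
  have "{ws. (fscale a x + y) ws \<noteq> 0} \<subseteq> {ws. x ws \<noteq> 0} \<union> {ws. y ws \<noteq> 0}"
    by (auto simp: fscale_def)
  then show ?case
    by (rule finite_subset) (use step x finite_support_oriented_simplex[of vs] in simp)
qed

lemma finite_cons_support:
  assumes "finite {ws. c ws \<noteq> 0}"
  shows "finite {v. c (v # ws) \<noteq> 0}"
  using finite_vimageI[OF assms, of "\<lambda>v. v # ws"] by (simp add: inj_def vimage_def)

lemma boundary_add:
  assumes "finite {ws. c ws \<noteq> 0}" "finite {ws. d ws \<noteq> 0}"
  shows "boundary (c + d) = boundary c + boundary d"
proof
  fix ws
  let ?C = "{v. c (v # ws) \<noteq> 0}" and ?D = "{v. d (v # ws) \<noteq> 0}"
  have fin: "finite (?C \<union> ?D)"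
    using assms by (simp add: finite_cons_support)
  have "(\<Sum>v | c (v # ws) + d (v # ws) \<noteq> 0. c (v # ws) + d (v # ws))
      = (\<Sum>v\<in>?C \<union> ?D. c (v # ws) + d (v # ws))"
    by (rule sum.mono_neutral_left[OF fin]) auto
  also have "\<dots> = (\<Sum>v\<in>?C \<union> ?D. c (v # ws)) + (\<Sum>v\<in>?C \<union> ?D. d (v # ws))"
    by (rule sum.distrib)
  also have "(\<Sum>v\<in>?C \<union> ?D. c (v # ws)) = (\<Sum>v\<in>?C. c (v # ws))"
    by (rule sum.mono_neutral_right[OF fin]) auto
  also have "(\<Sum>v\<in>?C \<union> ?D. d (v # ws)) = (\<Sum>v\<in>?D. d (v # ws))"
    by (rule sum.mono_neutral_right[OF fin]) auto
  finally show "boundary (c + d) ws = (boundary c + boundary d) ws"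
    by (simp add: boundary_def)
qed

lemma boundary_fscale:
  "boundary (fscale a c) = fscale a (boundary c)"
  by (cases "a = 0") (auto simp: boundary_def fscale_def sum_distrib_left fun_eq_iff)

lemma oriented_simplex_swap:
  assumes "distinct (as @ x # y # bs)"
  shows "oriented_simplex (as @ y # x # bs) ws
    = - (oriented_simplex (as @ x # y # bs) ws :: 'k::field)"
proof -
  have p: "transpose x y permutes set (as @ x # y # bs)"
    by (rule permutes_swap_id) auto
  have "map (transpose x y) (as @ x # y # bs) = as @ y # x # bs"
    using assms by (auto intro!: map_idI transpose_apply_other)
  with oriented_simplex_permute[OF p, where ?'k = 'k] assms show ?thesis
    by (simp add: fscale_def sign_swap_id)
qed

lemma oriented_simplex_move:
  assumes "distinct (as @ x # bs)"
  shows "oriented_simplex (as @ x # bs) ws = (-1) ^ length as * oriented_simplex (x # as @ bs) ws"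
  using assms
proof (induction as arbitrary: bs rule: rev_induct)
  case (snoc y as)
  then have "oriented_simplex (as @ y # x # bs) ws
      = - (oriented_simplex (as @ x # y # bs) ws :: 'b)"
    by (intro oriented_simplex_swap) auto
  moreover have "distinct (as @ x # y # bs)"
    using snoc.prems by auto
  ultimately show ?case by (simp add: snoc.IH)
qed simp

lemma oriented_simplex_Cons:
  assumes "x \<notin> set us"
  shows "oriented_simplex (x # us) (x # ws) = oriented_simplex us ws"
proof -
  have "\<pi> permutes set us" if "\<pi> permutes insert x (set us)" "\<pi> x = x" for \<pi>
    using that by (intro permutes_superset[OF that(1)]) auto
  moreover have "\<pi> permutes insert x (set us)" "\<pi> x = x" if "\<pi> permutes set us" for \<pi>
    using permutes_subset[OF that subset_insertI] permutes_not_in[OF that assms] by auto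
  ultimately have "{\<pi>. \<pi> permutes set (x # us) \<and> map \<pi> (x # us) = x # ws}
      = {\<pi>. \<pi> permutes set us \<and> map \<pi> us = ws}"
    by auto
  then show ?thesis by (simp add: oriented_simplex_def)
qed

lemma boundary_oriented_simplex:
  assumes "distinct vs" "length vs \<ge> 2"
  shows "boundary (oriented_simplex vs :: 'v list \<Rightarrow> 'k::field)
    = (\<Sum>i<length vs. fscale ((-1) ^ i) (oriented_simplex (take i vs @ drop (Suc i) vs)))"
proof
  fix ws
  let ?r = "\<lambda>i. (-1) ^ i * oriented_simplex (take i vs @ drop (Suc i) vs) ws :: 'k"
  have key: "oriented_simplex vs (vs ! i # ws) = ?r i" if i: "i < length vs" for i
  proof -
    have vs: "vs = take i vs @ vs ! i # drop (Suc i) vs"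
      using i by (rule id_take_nth_drop)
    then have d: "distinct (take i vs @ vs ! i # drop (Suc i) vs)"
      using assms(1) by metis
    have "oriented_simplex vs (vs ! i # ws)
        = (-1) ^ i * (oriented_simplex (vs ! i # take i vs @ drop (Suc i) vs) (vs ! i # ws) :: 'k)"
      using oriented_simplex_move[OF d, of "vs ! i # ws"] vs i by simp
    also have "\<dots> = ?r i"
      using d by (subst oriented_simplex_Cons) auto
    finally show ?thesis .
  qed
  have "(\<Sum>v | oriented_simplex vs (v # ws) \<noteq> (0::'k). oriented_simplex vs (v # ws))
      = (\<Sum>v\<in>set vs. oriented_simplex vs (v # ws) :: 'k)"
  proof (rule sum.mono_neutral_left)
    show "{v. oriented_simplex vs (v # ws) \<noteq> (0::'k)} \<subseteq> set vs"
      using oriented_simplex_nonzero[of vs "_ # ws", where ?'k = 'k] by force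
  qed auto
  also have "\<dots> = (\<Sum>i<length vs. oriented_simplex vs (vs ! i # ws))"
    using assms(1) by (intro sum.reindex_bij_betw[symmetric] bij_betw_nth) auto
  also have "\<dots> = (\<Sum>i<length vs. ?r i)"
    using key by simp
  finally have main: "(\<Sum>v | oriented_simplex vs (v # ws) \<noteq> (0::'k). oriented_simplex vs (v # ws))
      = (\<Sum>i<length vs. ?r i)" .
  have empty: "(\<Sum>i<length vs. ?r i) = 0" if "ws = []"
  proof (rule sum.neutral, intro ballI)
    fix i assume "i \<in> {..<length vs}"
    then have "length (take i vs @ drop (Suc i) vs) \<noteq> length ws"
      using that assms(2) by auto
    then show "?r i = 0"
      using oriented_simplex_nonzero by (metis mult_zero_right)
  qed
  have app: "(\<Sum>i\<in>I. g i) ws = (\<Sum>i\<in>I. g i ws)" for I and g :: "nat \<Rightarrow> 'v list \<Rightarrow> 'k"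
    by (induction I rule: infinite_finite_induct) auto
  show "boundary (oriented_simplex vs :: 'v list \<Rightarrow> 'k) ws
    = (\<Sum>i<length vs. fscale ((-1) ^ i) (oriented_simplex (take i vs @ drop (Suc i) vs))) ws"
    unfolding app using main empty by (auto simp: boundary_def fscale_def)
qed

lemma boundary_vertex: "boundary (oriented_simplex [v] :: 'v list \<Rightarrow> 'k::field) = 0"
proof
  fix ws
  have "oriented_simplex [v] (u # ws) = (0::'k)" if "ws \<noteq> []" for u
    using that oriented_simplex_nonzero[of "[v]" "u # ws", where ?'k = 'k] by force
  then show "boundary (oriented_simplex [v]) ws = (0 :: 'v list \<Rightarrow> 'k) ws"
    by (simp add: boundary_def)
qed

definition cycles :: "'v set set \<Rightarrow> int \<Rightarrow> ('v list \<Rightarrow> 'k::field) set" where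
  "cycles K n = {c \<in> chains K n. boundary c = 0}"

definition boundaries :: "'v set set \<Rightarrow> int \<Rightarrow> ('v list \<Rightarrow> 'k::field) set" where
  "boundaries K n = boundary ` chains K (n + 1)"

definition homology :: "'v set set \<Rightarrow> int \<Rightarrow> ('k::field, ('v list \<Rightarrow> 'k) set) vspace" where
  "homology K n = quotient_space (cycles K n) (boundaries K n)"


section \<open>The Leray spectral sequence\<close>

text \<open>\<open>filt_chains X Y f p q\<close> is the subspace \<open>X\<^bsub>p,q\<^esub>\<close> of the \<open>(p+q)\<close>-chains of \<open>X\<close>.\<close>

definition filt_chains ::
    "'v set set \<Rightarrow> 'w set set \<Rightarrow> ('v \<Rightarrow> 'w) \<Rightarrow> int \<Rightarrow> int \<Rightarrow> ('v list \<Rightarrow> 'k::field) set" where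
  "filt_chains X Y f p q = fun_vs.span
    {oriented_simplex vs | vs. distinct vs \<and> set vs \<in> X \<and> simplex_dim (set vs) = p + q
      \<and> f ` set vs \<in> skeleton Y p}"

definition leray_B ::
    "'v set set \<Rightarrow> 'w set set \<Rightarrow> ('v \<Rightarrow> 'w) \<Rightarrow> int \<Rightarrow> int \<Rightarrow> int \<Rightarrow> ('v list \<Rightarrow> 'k::field) set" where
  "leray_B X Y f r p q = filt_chains X Y f p q \<inter> boundary ` filt_chains X Y f (p + r) (q - r + 1)"

definition leray_Z ::
    "'v set set \<Rightarrow> 'w set set \<Rightarrow> ('v \<Rightarrow> 'w) \<Rightarrow> int \<Rightarrow> int \<Rightarrow> int \<Rightarrow> ('v list \<Rightarrow> 'k::field) set" where
  "leray_Z X Y f r p q = filt_chains X Y f p q \<inter> boundary -` filt_chains X Y f (p - r) (q + r - 1)"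

definition leray_D ::
    "'v set set \<Rightarrow> 'w set set \<Rightarrow> ('v \<Rightarrow> 'w) \<Rightarrow> int \<Rightarrow> int \<Rightarrow> int \<Rightarrow> ('v list \<Rightarrow> 'k::field) set" where
  "leray_D X Y f r p q = leray_Z X Y f (r - 1) (p - 1) (q + 1) + leray_B X Y f (r - 1) p q"

definition leray_E ::
    "'v set set \<Rightarrow> 'w set set \<Rightarrow> ('v \<Rightarrow> 'w) \<Rightarrow> int \<Rightarrow> int \<Rightarrow> int
      \<Rightarrow> ('k::field, ('v list \<Rightarrow> 'k) set) vspace" where
  "leray_E X Y f r p q = quotient_space (leray_Z X Y f r p q) (leray_D X Y f r p q)"

text \<open>For \<open>r > dim Y\<close>, the filtration of the \<open>n\<close>-th homology of \<open>X\<close> by the classes of cycles in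
  \<open>X\<^bsub>p,n-p\<^esub>\<close> is canonical, and so are the maps sending such a class to the class of the same cycle
  in \<open>E\<^sup>r\<^bsub>p,n-p\<^esub>\<close>. The filtration has in general no canonical splitting, so an isomorphism onto the
  sum of the graded pieces is called canonical if its \<open>p\<close>-th component extends the \<open>p\<close>-th of these
  maps, for every \<open>p\<close>. A cycle in \<open>X\<^bsub>p,n-p\<^esub>\<close> also lies in \<open>X\<^bsub>p',n-p'\<^esub>\<close> for \<open>p' > p\<close>, with zero
  class in \<open>E\<^sup>r\<^bsub>p',n-p'\<^esub>\<close>, so such an isomorphism is compatible with the filtrations.\<close>

definition canonical_on_filtration ::
    "'v set set \<Rightarrow> 'w set set \<Rightarrow> ('v \<Rightarrow> 'w) \<Rightarrow> int \<Rightarrow> int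
      \<Rightarrow> (('v list \<Rightarrow> 'k::field) set \<Rightarrow> int \<Rightarrow> ('v list \<Rightarrow> 'k) set) \<Rightarrow> bool" where
  "canonical_on_filtration X Y f r n \<phi> \<longleftrightarrow>
    (\<forall>p\<in>{0..n}. \<forall>z \<in> cycles X n \<inter> filt_chains X Y f p (n - p).
      \<phi> (z +o boundaries X n) p = z +o leray_D X Y f r p (n - p))"

end

theory Submission
  imports Defs
begin

text \<open>
  Fix \<open>n\<close> and let \<open>F\<^sub>p\<close> be the space of those \<open>n\<close>-cycles of \<open>X\<close> that are supported over the
  \<open>p\<close>-skeleton of \<open>Y\<close>. These spaces increase with \<open>p\<close>; they vanish for \<open>p < 0\<close>, and \<open>F\<^sub>n\<close> consists of
  all \<open>n\<close>-cycles because a simplicial map does not raise dimensions. Hence the homology is the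
  quotient of \<open>F\<^sub>n\<close> by the boundaries \<open>B\<close>, filtered by the images of the \<open>F\<^sub>p\<close>, and its \<open>p\<close>-th graded
  piece is \<open>F\<^sub>p / (F\<^sub>p \<inter> (F\<^bsub>p-1\<^esub> + B))\<close>.

  The terms \<open>E\<^sup>r\<close> with \<open>r = m + 1\<close> are these graded pieces, since \<open>r\<close> exceeds the length of the
  filtration. Let \<open>0 \<le> p \<le> m\<close>. A chain in the numerator has its boundary over the skeleton of
  dimension \<open>p - m - 1 < 0\<close>, so it is a cycle: the numerator is \<open>F\<^sub>p\<close>. Likewise
  \<open>Z\<^sup>m\<^bsub>p-1,n-p+1\<^esub> = F\<^bsub>p-1\<^esub>\<close>. Every chain of \<open>X\<close> lies over the skeleton of dimension \<open>p + m \<ge> m\<close>, so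
  \<open>B\<^sup>m\<^bsub>p,n-p\<^esub>\<close> consists of all boundaries supported over the \<open>p\<close>-skeleton. By the modular law the
  denominator is then \<open>F\<^sub>p \<inter> (F\<^bsub>p-1\<^esub> + B)\<close>. For \<open>p > m\<close> nothing happens on either side: the filtration
  of the cycles is already constant, and the term of the spectral sequence is \<open>0\<close>.

  Over a field a finite filtration splits. The splitting is built here from linear maps \<open>\<rho>\<^sub>p\<close> into
  \<open>F\<^sub>p\<close> that kill \<open>F\<^bsub>p-1\<^esub> + B\<close> and induce the identity on the \<open>p\<close>-th graded piece
  (\<open>exists_retraction_modulo\<close>). The map with components \<open>\<rho>\<^sub>p\<close> is canonical on the filtration by
  construction, and it is bijective by an induction along the filtration
  (\<open>filtered_quotient_iso_graded\<close>).
\<close>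

section \<open>Splitting a filtered quotient\<close>

text \<open>The inclusion of \<open>U / (U \<inter> A)\<close> into the quotient by \<open>A\<close> has a linear retraction, here lifted to
  the ambient space. Extend a basis of \<open>A\<close> by vectors of \<open>U\<close> to a basis of \<open>A + U\<close>, and let \<open>\<rho>\<close> kill
  the former vectors and fix the latter.\<close>

lemma (in vector_space) exists_retraction_modulo:
  assumes U: "subspace U" and A: "subspace A"
  obtains \<rho> where "Vector_Spaces.linear scale scale \<rho>" "\<And>v. \<rho> v \<in> U" "\<And>a. a \<in> A \<Longrightarrow> \<rho> a = 0"
    "\<And>u. u \<in> U \<Longrightarrow> \<rho> u - u \<in> U \<inter> A"
proof -
  interpret vector_space_pair scale scale ..
  obtain S where S: "S \<subseteq> A" "independent S" "A \<subseteq> span S"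
    using basis_exists by metis
  obtain T where T: "S \<subseteq> T" "T \<subseteq> S \<union> U" "independent T" "S \<union> U \<subseteq> span T"
    using maximal_independent_subset_extend[OF Un_upper1 S(2)] by metis
  let ?g = "\<lambda>b. if b \<in> S then 0 else b"
  obtain \<rho> where \<rho>: "Vector_Spaces.linear scale scale \<rho>" "\<forall>x\<in>T. \<rho> x = ?g x" "range \<rho> = span (?g ` T)"
    \<comment> \<open>The control of the range keeps the values of \<open>\<rho>\<close> in \<open>U\<close> on the whole space.\<close>
    using linear_independent_extend_subspace[OF T(3), of ?g] by blast
  interpret \<rho>: Vector_Spaces.linear scale scale \<rho> by (rule \<rho>(1))
  have "?g ` T \<subseteq> U"
    using T(2) subspace_0[OF U] by auto
  then have range: "\<rho> v \<in> U" for v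
    using \<rho>(3) span_minimal[OF _ U] by blast
  have "\<rho> a = 0" if "a \<in> span S" for a
    using that by (induction rule: span_induct_alt) (use \<rho>(2) T(1) in \<open>auto simp: \<rho>.add \<rho>.scale\<close>)
  then have zero: "\<rho> a = 0" if "a \<in> A" for a
    using that S(3) by blast
  have "\<rho> u - u \<in> A" if "u \<in> span T" for u
    using that
  proof (induction rule: span_induct_alt)
    case base
    then show ?case by (simp add: \<rho>.zero subspace_0[OF A])
  next
    case (step c x y)
    have "\<rho> x - x \<in> A"
      using step(1) \<rho>(2) S(1) subspace_0[OF A] subspace_neg[OF A] by auto
    then have "c *s (\<rho> x - x) + (\<rho> y - y) \<in> A"
      using step A by (simp add: subspace_add subspace_scale)
    then show ?case
      by (simp add: \<rho>.add \<rho>.scale algebra_simps)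
  qed
  then have "\<rho> u - u \<in> U \<inter> A" if "u \<in> U" for u
    using that T(4) range subspace_diff[OF U] by auto
  with \<rho>(1) range zero that show thesis by blast
qed

lemma coset_eq_iff:
  assumes W: "fun_vs.subspace W"
  shows "v +o W = w +o W \<longleftrightarrow> v - w \<in> W"
proof
  assume "v +o W = w +o W"
  moreover have "v + 0 \<in> v +o W"
    using fun_vs.subspace_0[OF W] by (rule set_plus_intro2)
  ultimately have "v \<in> w +o W" by simp
  then show "v - w \<in> W" by (auto simp: elt_set_plus_def)
next
  assume vw: "v - w \<in> W"
  have "a +o W \<subseteq> b +o W" if "a - b \<in> W" for a b
  proof
    fix x assume "x \<in> a +o W"
    then obtain c where c: "c \<in> W" "x = a + c" by (auto simp: elt_set_plus_def)
    then have "x = b + ((a - b) + c)" by simp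
    then show "x \<in> b +o W"
      using fun_vs.subspace_add[OF W that c(1)] by (metis set_plus_intro2)
  qed
  from this[OF vw] this[of w v] vw show "v +o W = w +o W"
    using fun_vs.subspace_neg[OF W vw] by auto
qed

lemma subspace_set_plus:
  "fun_vs.subspace A \<Longrightarrow> fun_vs.subspace B \<Longrightarrow> fun_vs.subspace (A + B)"
proof -
  have "A + B = {x + y |x y. x \<in> A \<and> y \<in> B}" by (auto simp: set_plus_def)
  then show "fun_vs.subspace A \<Longrightarrow> fun_vs.subspace B \<Longrightarrow> fun_vs.subspace (A + B)"
    using fun_vs.subspace_sums[of A B] by simp
qed

lemma subset_set_plus:
  assumes "fun_vs.subspace A" "fun_vs.subspace B"
  shows "A \<subseteq> A + B" "B \<subseteq> A + B"
  using set_plus_intro[OF _ fun_vs.subspace_0[OF assms(2)]]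
    set_plus_intro[OF fun_vs.subspace_0[OF assms(1)]] by force+

text \<open>The spaces \<open>G p / D p\<close> are presentations of the graded pieces of \<open>F n / B\<close>: the last three
  assumptions say that the inclusion of \<open>F p\<close> into \<open>G p\<close> induces an isomorphism from
  \<open>F p / (F p \<inter> (F (p - 1) + B))\<close> onto \<open>G p / D p\<close>. Letting \<open>G p\<close> differ from \<open>F p\<close> covers the degrees
  in which the numerator of a term of the spectral sequence contains chains that are not cycles.\<close>

lemma filtered_quotient_iso_graded:
  fixes F G D :: "int \<Rightarrow> ('i \<Rightarrow> 'k::field) set"
  assumes B: "fun_vs.subspace B" and F: "\<And>p. fun_vs.subspace (F p)"
    and D: "\<And>p. fun_vs.subspace (D p)"
    and mono: "\<And>p q. p \<le> q \<Longrightarrow> F p \<subseteq> F q" and bot: "F (-1) \<subseteq> B" and n: "n \<ge> 0"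
    and FG: "\<And>p. p \<in> {0..n} \<Longrightarrow> F p \<subseteq> G p"
    and GF: "\<And>p. p \<in> {0..n} \<Longrightarrow> G p \<subseteq> F p + D p"
    and FD: "\<And>p. p \<in> {0..n} \<Longrightarrow> F p \<inter> D p = F p \<inter> (F (p - 1) + B)"
  shows "\<exists>\<phi>. vspace_iso (quotient_space (F n) B)
      (direct_sum {0..n} (\<lambda>p. quotient_space (G p) (D p))) \<phi>
    \<and> (\<forall>p\<in>{0..n}. \<forall>z\<in>F p. \<phi> (z +o B) p = z +o D p)"
proof -
  have A: "fun_vs.subspace (F p + B)" for p
    by (rule subspace_set_plus[OF F B])
  have "\<exists>\<rho>. Vector_Spaces.linear fscale fscale \<rho> \<and> (\<forall>v. \<rho> v \<in> F p)
      \<and> (\<forall>a\<in>F (p - 1) + B. \<rho> a = 0) \<and> (\<forall>u\<in>F p. \<rho> u - u \<in> F p \<inter> (F (p - 1) + B))" for p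
    by (rule fun_vs.exists_retraction_modulo[OF F A, of p "p - 1"]) blast
  then obtain \<rho> where lin: "\<And>p. Vector_Spaces.linear fscale fscale (\<rho> p)"
    and \<rho>F: "\<And>p v. \<rho> p v \<in> F p"
    and \<rho>0: "\<And>p a. a \<in> F (p - 1) + B \<Longrightarrow> \<rho> p a = 0"
    and \<rho>A: "\<And>p u. u \<in> F p \<Longrightarrow> \<rho> p u - u \<in> F p \<inter> (F (p - 1) + B)"
    by metis
  note add = Vector_Spaces.linear.axioms(3)[OF lin, THEN module_hom.add]
  note scale = Vector_Spaces.linear.axioms(3)[OF lin, THEN module_hom.scale]
  note diff = Vector_Spaces.linear.axioms(3)[OF lin, THEN module_hom.diff]
  have \<rho>B: "\<rho> p b = 0" if "b \<in> B" for p b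
    using that \<rho>0 subset_set_plus(2)[OF F B] by blast
  have \<rho>D: "\<rho> p u - u \<in> D p" if "u \<in> F p" "p \<in> {0..n}" for p u
    using \<rho>A[OF that(1)] FD[OF that(2)] by blast
  \<comment> \<open>Taking the image of the whole coset avoids a choice of representatives: \<open>\<rho> p\<close> is constant on
    cosets of \<open>B\<close>.\<close>
  define \<phi> where "\<phi> C = (\<lambda>p\<in>{0..n}. \<rho> p ` C + D p)" for C
  have \<phi>: "\<phi> (z +o B) = (\<lambda>p\<in>{0..n}. \<rho> p z +o D p)" for z
  proof -
    have "\<rho> p ` (z +o B) = {\<rho> p z}" for p
      using fun_vs.subspace_0[OF B] by (auto simp: elt_set_plus_def add \<rho>B image_iff intro!: bexI[of _ 0])
    then show ?thesis
      by (simp add: \<phi>_def set_plus_def elt_set_plus_def)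
  qed

  \<comment> \<open>Injectivity: if every component of \<open>z\<close> vanishes, then \<open>z\<close> can be pushed down the filtration one
    step at a time, modulo \<open>B\<close>.\<close>
  have kernel: "z \<in> B" if z: "z \<in> F n" and zD: "\<And>p. p \<in> {0..n} \<Longrightarrow> \<rho> p z \<in> D p" for z
  proof -
    have "j \<ge> -1 \<longrightarrow> z \<in> F j + B" if "j \<le> n" for j
      using that
    proof (induction j rule: int_le_induct)
      case base
      then show ?case using z subset_set_plus(1)[OF F B] by blast
    next
      case (step j)
      show ?case
      proof
        assume "- 1 \<le> j - 1"
        then have j: "j \<in> {0..n}" using step by auto
        then obtain a b where ab: "a \<in> F j" "b \<in> B" "z = a + b"
          using step by (auto simp: set_plus_def)
        have "\<rho> j z = \<rho> j a" using ab by (simp add: add \<rho>B)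
        then have "\<rho> j a \<in> F (j - 1) + B"
          using zD[OF j] \<rho>F[of j z] FD[OF j] by auto
        then have "\<rho> j a - (\<rho> j a - a) + b \<in> F (j - 1) + B"
          using \<rho>A[OF ab(1)] ab(2) subset_set_plus(2)[OF F B] fun_vs.subspace_diff[OF A] fun_vs.subspace_add[OF A]
          by blast
        then show "z \<in> F (j - 1) + B" using ab by simp
      qed
    qed
    from this[of "-1"] have "z \<in> F (-1) + B" using n by simp
    then show ?thesis
      using bot fun_vs.subspace_add[OF B] by (auto simp: set_plus_def)
  qed

  \<comment> \<open>Surjectivity: prescribe the components from \<open>p = n\<close> downwards. The \<open>p\<close>-th one is corrected by an
    element of \<open>F p\<close>, which all \<open>\<rho> q\<close> with \<open>q > p\<close> kill.\<close>
  have lift: "\<exists>z\<in>F n. \<forall>p\<in>{0..n}. \<rho> p z - g p \<in> D p" if g: "\<And>p. p \<in> {0..n} \<Longrightarrow> g p \<in> F p" for g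
  proof -
    have "j \<ge> 0 \<longrightarrow> (\<exists>z\<in>F n. \<forall>p\<in>{j..n}. \<rho> p z - g p \<in> D p)" if "j \<le> n + 1" for j
      using that
    proof (induction j rule: int_le_induct)
      case base
      then show ?case using fun_vs.subspace_0[OF F] by auto
    next
      case (step j)
      show ?case
      proof
        assume j0: "0 \<le> j - 1"
        then obtain z where z: "z \<in> F n" "\<And>p. p \<in> {j..n} \<Longrightarrow> \<rho> p z - g p \<in> D p"
          using step.IH by (metis diff_ge_0_iff_ge order_trans zero_le_one)
        define w where "w = g (j - 1) - \<rho> (j - 1) z"
        have j: "j - 1 \<in> {0..n}" using j0 step by auto
        have w: "w \<in> F (j - 1)"
          unfolding w_def using g[OF j] \<rho>F by (rule fun_vs.subspace_diff[OF F])
        have "w \<in> F n" using w mono[of "j - 1" n] j by auto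
        then have "z + w \<in> F n" using z(1) fun_vs.subspace_add[OF F] by blast
        moreover have "\<rho> p (z + w) - g p \<in> D p" if p: "p \<in> {j - 1..n}" for p
        proof (cases "p = j - 1")
          case True
          then have "\<rho> p (z + w) - g p = \<rho> (j - 1) w - w"
            by (simp add: add w_def)
          then show ?thesis using \<rho>D[OF w j] True by simp
        next
          case False
          then have p': "p \<in> {j..n}" using p by auto
          then have "w \<in> F (p - 1)" using w mono[of "j - 1" "p - 1"] by auto
          then have "\<rho> p w = 0" using \<rho>0 subset_set_plus(1)[OF F B] by blast
          then show ?thesis using z(2)[OF p'] by (simp add: add)
        qed
        ultimately show "\<exists>z\<in>F n. \<forall>p\<in>{j - 1..n}. \<rho> p z - g p \<in> D p" by blast
      qed
    qed
    from this[of 0] show ?thesis using n by simp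
  qed

  let ?E = "direct_sum {0..n} (\<lambda>p. quotient_space (G p) (D p))"
  have qc: "carrier (quotient_space V W) = (\<lambda>v. v +o W) ` V" for V W :: "('i \<Rightarrow> 'k) set"
    by (simp add: quotient_space_def)
  have inj: "inj_on \<phi> (carrier (quotient_space (F n) B))"
  proof (rule inj_onI)
    fix C C' assume "C \<in> carrier (quotient_space (F n) B)" "C' \<in> carrier (quotient_space (F n) B)"
      and eq: "\<phi> C = \<phi> C'"
    then obtain z z' where z: "z \<in> F n" "z' \<in> F n" and C: "C = z +o B" "C' = z' +o B"
      by (auto simp: qc)
    have "z - z' \<in> B"
    proof (rule kernel)
      show "z - z' \<in> F n" using z by (rule fun_vs.subspace_diff[OF F])
      fix p assume p: "p \<in> {0..n}"
      with fun_cong[OF eq, of p] have "\<rho> p z +o D p = \<rho> p z' +o D p"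
        by (simp add: C \<phi>)
      then show "\<rho> p (z - z') \<in> D p"
        by (simp add: coset_eq_iff[OF D] diff)
    qed
    then show "C = C'" by (simp add: C coset_eq_iff[OF B])
  qed
  have surj: "\<phi> ` carrier (quotient_space (F n) B) = carrier ?E"
  proof (intro equalityI subsetI)
    fix y assume "y \<in> \<phi> ` carrier (quotient_space (F n) B)"
    then obtain z where "y = (\<lambda>p\<in>{0..n}. \<rho> p z +o D p)" by (auto simp: qc \<phi>)
    then show "y \<in> carrier ?E"
      using subsetD[OF FG \<rho>F] by (auto simp: direct_sum_def qc intro!: imageI)
  next
    fix y assume y: "y \<in> carrier ?E"
    have "\<exists>g\<in>F p. y p = g +o D p" if p: "p \<in> {0..n}" for p
    proof -
      from y have "y \<in> (\<Pi>\<^sub>E j\<in>{0..n}. (\<lambda>v. v +o D j) ` G j)"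
        by (simp add: direct_sum_def qc)
      from PiE_mem[OF this p] have "y p \<in> (\<lambda>v. v +o D p) ` G p"
        .
      then obtain v where v: "v \<in> G p" "y p = v +o D p" by blast
      then obtain u d where ud: "u \<in> F p" "d \<in> D p" "v = u + d"
        using GF[OF p] by (auto simp: set_plus_def)
      then have "v +o D p = u +o D p" by (simp add: coset_eq_iff[OF D])
      with v ud show ?thesis by auto
    qed
    then obtain g where g: "\<And>p. p \<in> {0..n} \<Longrightarrow> g p \<in> F p" "\<And>p. p \<in> {0..n} \<Longrightarrow> y p = g p +o D p"
      by metis
    obtain z where z: "z \<in> F n" "\<And>p. p \<in> {0..n} \<Longrightarrow> \<rho> p z - g p \<in> D p"
      using lift[of g] g(1) by blast
    have "y = \<phi> (z +o B)"
    proof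
      fix p
      show "y p = \<phi> (z +o B) p"
      proof (cases "p \<in> {0..n}")
        case True
        then show ?thesis using z(2) g(2) coset_eq_iff[OF D, of "\<rho> p z" p "g p"] by (simp add: \<phi>)
      next
        case False
        then have "y p = undefined"
          using y by (auto simp: direct_sum_def PiE_def extensional_def)
        then show ?thesis using False by (auto simp: \<phi>)
      qed
    qed
    then show "y \<in> \<phi> ` carrier (quotient_space (F n) B)"
      using z(1) by (auto simp: qc)
  qed
  have vadd: "\<phi> (vadd (quotient_space (F n) B) x y) = vadd ?E (\<phi> x) (\<phi> y)"
    if "x \<in> carrier (quotient_space (F n) B)" "y \<in> carrier (quotient_space (F n) B)" for x y
    using that by (auto simp: qc quotient_space_vadd[OF B] quotient_space_vadd[OF D] \<phi> direct_sum_def add fun_eq_iff)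
  have vscale: "\<phi> (vscale (quotient_space (F n) B) a x) = vscale ?E a (\<phi> x)"
    if "x \<in> carrier (quotient_space (F n) B)" for a x
    using that by (auto simp: qc quotient_space_vscale[OF B] quotient_space_vscale[OF D] \<phi> direct_sum_def scale fun_eq_iff)
  have canonical: "\<phi> (z +o B) p = z +o D p" if "p \<in> {0..n}" "z \<in> F p" for p z
    using that \<rho>D by (simp add: \<phi> coset_eq_iff[OF D])
  show ?thesis
    unfolding vspace_iso_def bij_betw_def
    by (intro exI[of _ \<phi>] conjI ballI allI) (fact inj surj vadd vscale canonical)+
qed

section \<open>The boundary on chains\<close>

text \<open>Chains are alternating functions of the ordered vertices. The proof that the boundary squares to
  zero rests on this and on finite support: the value of the double boundary at a list is a double sum over the two
  vertices put in front. The vanishing on repeated vertices is a separate fact, because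
  antisymmetry does not imply it in characteristic \<open>2\<close>.\<close>

lemma oriented_simplex_swap_argument:
  fixes vs :: "'v list"
  assumes vs: "distinct vs"
  shows "oriented_simplex vs (v # v # ws) = (0 :: 'k::field)"
    and "oriented_simplex vs (v # u # ws) = - (oriented_simplex vs (u # v # ws) :: 'k)"
proof -
  show diag: "oriented_simplex vs (v # v # ws) = (0 :: 'k)" for v
  proof (rule ccontr)
    assume "oriented_simplex vs (v # v # ws) \<noteq> (0 :: 'k)"
    then have "set (v # v # ws) = set vs" "length (v # v # ws) = length vs"
      using oriented_simplex_nonzero by metis+
    then show False using vs by (metis card_distinct distinct_card distinct_length_2_or_more)
  qed
  show "oriented_simplex vs (v # u # ws) = - (oriented_simplex vs (u # v # ws) :: 'k)"
  proof (cases "u = v \<or> oriented_simplex vs (u # v # ws) = (0::'k) \<and> oriented_simplex vs (v # u # ws) = (0::'k)")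
    case True
    then show ?thesis using diag by auto
  next
    case False
    then have "u \<noteq> v" by blast
    from False have "set (u # v # ws) = set vs \<and> length (u # v # ws) = length vs"
      using oriented_simplex_nonzero[of vs "u # v # ws", where ?'k = 'k]
        oriented_simplex_nonzero[of vs "v # u # ws", where ?'k = 'k]
      by (auto simp: insert_commute)
    then have uv: "u \<noteq> v" "distinct (u # v # ws)" "set (u # v # ws) = set vs"
      using vs \<open>u \<noteq> v\<close> by (metis, metis card_distinct distinct_card, metis)
    \<comment> \<open>Composing with the transposition of \<open>u\<close> and \<open>v\<close> matches the permutations counted on the two
      sides and flips their signs.\<close>
    let ?t = "transpose u v"
    have t: "?t permutes set vs" using uv(3) by (intro permutes_swap_id) auto
    have map_t: "map ?t (u # v # ws) = v # u # ws" "map ?t (v # u # ws) = u # v # ws"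
      using uv(2) by (auto intro!: map_idI transpose_apply_other)
    have "oriented_simplex vs (v # u # ws)
        = (\<Sum>\<pi> | \<pi> permutes set vs \<and> map \<pi> vs = u # v # ws. - (of_int (sign \<pi>) :: 'k))"
      unfolding oriented_simplex_def
    proof (rule sum.reindex_bij_witness[where i="\<lambda>\<pi>. ?t \<circ> \<pi>" and j="\<lambda>\<pi>. ?t \<circ> \<pi>"])
      fix \<pi> assume \<pi>: "\<pi> \<in> {\<pi>. \<pi> permutes set vs \<and> map \<pi> vs = v # u # ws}"
      then have "permutation \<pi>" using permutation_permutes by blast
      then have "sign (?t \<circ> \<pi>) = - sign \<pi>"
        using uv(1) by (simp add: sign_compose permutation_swap_id sign_swap_id)
      then show "- of_int (sign (?t \<circ> \<pi>)) = (of_int (sign \<pi>) :: 'k)" by simp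
      show "?t \<circ> \<pi> \<in> {\<pi>. \<pi> permutes set vs \<and> map \<pi> vs = u # v # ws}"
        using \<pi> t map_t(2) by (auto simp: permutes_compose simp flip: map_map)
    next
      fix \<pi> assume \<pi>: "\<pi> \<in> {\<pi>. \<pi> permutes set vs \<and> map \<pi> vs = u # v # ws}"
      show "?t \<circ> \<pi> \<in> {\<pi>. \<pi> permutes set vs \<and> map \<pi> vs = v # u # ws}"
        using \<pi> t map_t(1) by (auto simp: permutes_compose simp flip: map_map)
    qed (auto simp: fun_eq_iff)
    then show ?thesis by (simp add: oriented_simplex_def sum_negf)
  qed
qed

lemma chains_alternating:
  fixes c :: "'v list \<Rightarrow> 'k::field"
  assumes "c \<in> chains K d"
  shows "c (v # v # ws) = 0" "c (v # u # ws) = - c (u # v # ws)"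
proof -
  have "c (v # v # ws) = 0 \<and> c (v # u # ws) = - c (u # v # ws)"
    using assms unfolding chains_def
  proof (induction rule: fun_vs.span_induct_alt)
    case base
    then show ?case by simp
  next
    case (step a x y)
    then obtain vs where vs: "x = oriented_simplex vs" "distinct vs" by blast
    show ?case
      using step.IH oriented_simplex_swap_argument(2)[OF vs(2), of v u ws, where ?'k = 'k]
      by (simp add: vs(1) fscale_def oriented_simplex_swap_argument(1)[OF vs(2)])
  qed
  then show "c (v # v # ws) = 0" "c (v # u # ws) = - c (u # v # ws)" by blast+
qed

text \<open>The terms cancel in pairs. Induction on \<open>S\<close> avoids dividing by \<open>2\<close> and choosing an order on \<open>S\<close>:
  a new element contributes one row and one column, which are negatives of each other.\<close>

lemma sum_alternating_eq_0:
  fixes g :: "'a \<Rightarrow> 'a \<Rightarrow> 'b::ab_group_add"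
  assumes "finite S" "\<And>v. g v v = 0" "\<And>u v. g v u = - g u v"
  shows "(\<Sum>v\<in>S. \<Sum>u\<in>S. g u v) = 0"
  using assms(1)
proof induction
  case (insert x S)
  have "(\<Sum>v\<in>S. g x v) = - (\<Sum>v\<in>S. g v x)"
    unfolding sum_negf[symmetric] by (rule sum.cong[OF refl assms(3)])
  then show ?case using insert by (simp add: sum.distrib assms(2))
qed simp

lemma boundary_boundary:
  assumes c: "c \<in> chains K d"
  shows "boundary (boundary c) = 0"
proof
  fix ws
  let ?h = "\<lambda>v. \<Sum>u | c (u # v # ws) \<noteq> 0. c (u # v # ws)"
  \<comment> \<open>A common finite range for both summations: all vertices that occur in \<open>c\<close>.\<close>
  define S where "S = (\<Union>ws\<in>{ws. c ws \<noteq> 0}. set ws)"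
  have S: "finite S" unfolding S_def using finite_support_chains[OF c] by auto
  have memS: "u \<in> S" "v \<in> S" if "c (u # v # ws) \<noteq> 0" for u v
    using that unfolding S_def by force+
  have inner: "?h v = (\<Sum>u\<in>S. c (u # v # ws))" for v
    by (rule sum.mono_neutral_left[OF S]) (use memS in auto)
  have "?h v = 0" if "v \<notin> S" for v
    using that memS by (intro sum.neutral) auto
  then have "(\<Sum>v | ?h v \<noteq> 0. ?h v) = (\<Sum>v\<in>S. ?h v)"
    by (intro sum.mono_neutral_left[OF S]) auto
  also have "\<dots> = 0"
    unfolding inner
    by (rule sum_alternating_eq_0[OF S, where g = "\<lambda>u v. c (u # v # ws)"])
      (rule chains_alternating[OF c])+
  finally show "boundary (boundary c) ws = (0 :: _ \<Rightarrow> _) ws"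
    by (simp add: boundary_def)
qed

lemma subspace_chains: "fun_vs.subspace (chains K d)"
  by (simp add: chains_def fun_vs.subspace_span)

lemma boundary_add_on_chains:
  assumes "c \<in> chains K d" "c' \<in> chains K d"
  shows "boundary (c + c') = boundary c + boundary c'"
  using assms by (intro boundary_add finite_support_chains)

lemma boundary_zero: "boundary 0 = 0"
  by (simp add: boundary_def fun_eq_iff)

lemma subspace_boundary_vimage:
  assumes "fun_vs.subspace V" "V \<subseteq> chains K d" "fun_vs.subspace W"
  shows "fun_vs.subspace (V \<inter> boundary -` W)"
proof -
  have "boundary (x + y) = boundary x + boundary y" if "x \<in> V" "y \<in> V" for x y
    using that assms(2) by (intro boundary_add_on_chains[of _ K d]) auto
  then show ?thesis
    using assms(1,3) unfolding fun_vs.subspace_def by (simp add: boundary_fscale boundary_zero)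
qed

lemma boundary_oriented_simplex_in_chains:
  assumes K: "simplicial_complex K" and vs: "distinct vs" "set vs \<in> K" "simplex_dim (set vs) = d"
  shows "boundary (oriented_simplex vs) \<in> chains K (d - 1)"
proof -
  have "vs \<noteq> []" using vs(2) K by (auto simp: simplicial_complex_def)
  show ?thesis
  proof (cases "length vs \<ge> 2")
    case True
    have "oriented_simplex (take i vs @ drop (Suc i) vs) \<in> chains K (d - 1)" if i: "i < length vs" for i
    proof -
      let ?us = "take i vs @ drop (Suc i) vs"
      have eq: "vs = take i vs @ vs ! i # drop (Suc i) vs"
        using i by (rule id_take_nth_drop)
      have "distinct (take i vs @ vs ! i # drop (Suc i) vs)"
        unfolding eq[symmetric] by (rule vs(1))
      then have us: "distinct ?us" by auto
      have sub: "set ?us \<subseteq> set vs"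
        by (auto dest: in_set_takeD in_set_dropD)
      have len: "length ?us = length vs - 1" using i by simp
      then have "length ?us \<noteq> 0" using True by linarith
      then have "set ?us \<noteq> {}" by (metis list.size(3) set_empty)
      then have "set ?us \<in> K"
        using K[unfolded simplicial_complex_def, THEN conjunct2, rule_format, OF vs(2)] sub by simp
      moreover have "simplex_dim (set ?us) = d - 1"
        using vs(3) True
        unfolding simplex_dim_def distinct_card[OF us] distinct_card[OF vs(1)] len by simp
      ultimately have "set ?us \<in> K" "simplex_dim (set ?us) = d - 1" by blast+
      then show ?thesis
        unfolding chains_def using us by (intro fun_vs.span_base) blast
    qed
    then show ?thesis
      unfolding boundary_oriented_simplex[OF vs(1) True]
      by (intro fun_vs.subspace_sum fun_vs.subspace_scale subspace_chains) auto
  next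
    case False
    then obtain v where "vs = [v]" using \<open>vs \<noteq> []\<close> by (cases vs) (auto simp: Suc_le_eq)
    then show ?thesis
      using fun_vs.subspace_0[OF subspace_chains] by (simp add: boundary_vertex)
  qed
qed

text \<open>By minimality of the span it suffices to treat the generators, since the chains whose boundary
  is again a chain form a subspace.\<close>

lemma boundary_in_chains:
  assumes K: "simplicial_complex K" and c: "c \<in> chains K d"
  shows "boundary c \<in> chains K (d - 1)"
proof -
  have "chains K d \<subseteq> chains K d \<inter> boundary -` chains K (d - 1)"
    unfolding chains_def[of K d]
  proof (rule fun_vs.span_minimal)
    show "fun_vs.subspace (fun_vs.span
        {oriented_simplex vs |vs. distinct vs \<and> set vs \<in> K \<and> simplex_dim (set vs) = d}
        \<inter> boundary -` chains K (d - 1))"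
      unfolding chains_def[of K d, symmetric]
      by (rule subspace_boundary_vimage[OF subspace_chains order_refl subspace_chains])
  qed (use boundary_oriented_simplex_in_chains[OF K] in \<open>auto intro: fun_vs.span_base\<close>)
  then show ?thesis using c by blast
qed

lemma subspace_boundary_image:
  assumes "fun_vs.subspace V" "V \<subseteq> chains K d"
  shows "fun_vs.subspace (boundary ` V)"
  unfolding fun_vs.subspace_def
proof (intro conjI ballI allI)
  show "0 \<in> boundary ` V"
    using fun_vs.subspace_0[OF assms(1)] boundary_zero by (metis imageI)
next
  fix x y assume "x \<in> boundary ` V" "y \<in> boundary ` V"
  then obtain c c' where "c \<in> V" "c' \<in> V" "x = boundary c" "y = boundary c'" by auto
  then show "x + y \<in> boundary ` V"
    using assms boundary_add_on_chains[of c K d c'] fun_vs.subspace_add[OF assms(1)]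
    by (metis imageI subset_iff)
next
  fix a x assume "x \<in> boundary ` V"
  then show "fscale a x \<in> boundary ` V"
    using fun_vs.subspace_scale[OF assms(1)] by (auto simp: boundary_fscale[symmetric])
qed

lemma cycles_vimage: "cycles K n = chains K n \<inter> boundary -` {0}"
  by (auto simp: cycles_def)

lemma boundaries_subset_cycles:
  assumes "simplicial_complex K"
  shows "boundaries K n \<subseteq> cycles K n"
  using boundary_in_chains[OF assms, of _ "n + 1"] boundary_boundary
  by (auto simp: boundaries_def cycles_def)

section \<open>The filtration by skeleta\<close>

lemma subspace_filt_chains: "fun_vs.subspace (filt_chains X Y f p q)"
  by (simp add: filt_chains_def fun_vs.subspace_span)

lemma filt_chains_subset_chains: "filt_chains X Y f p q \<subseteq> chains X (p + q)"
  unfolding filt_chains_def chains_def by (rule fun_vs.span_mono) blast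

lemma filt_chains_mono:
  assumes "p \<le> p'" "p + q = p' + q'"
  shows "filt_chains X Y f p q \<subseteq> filt_chains X Y f p' q'"
proof -
  have "skeleton Y p \<subseteq> skeleton Y p'" using assms(1) by (auto simp: skeleton_def)
  then show ?thesis
    unfolding filt_chains_def assms(2) by (intro fun_vs.span_mono) blast
qed

lemma filt_chains_negative:
  assumes "simplicial_complex Y" "p < 0"
  shows "filt_chains X Y f p q = {0}"
proof -
  have "skeleton Y p = {}"
  proof (intro equals0I)
    fix \<sigma> assume "\<sigma> \<in> skeleton Y p"
    then have "\<sigma> \<in> Y" "int (card \<sigma>) \<le> p + 1" by (simp_all add: skeleton_def simplex_dim_def)
    moreover have "card \<sigma> > 0"
      using \<open>\<sigma> \<in> Y\<close> assms(1) by (simp add: simplicial_complex_def card_gt_0_iff)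
    ultimately show False using assms(2) by linarith
  qed
  then show ?thesis by (simp add: filt_chains_def)
qed

lemma filt_chains_eq_chains:
  assumes "\<And>\<sigma>. \<sigma> \<in> X \<Longrightarrow> simplex_dim \<sigma> = p + q \<Longrightarrow> f ` \<sigma> \<in> skeleton Y p"
  shows "filt_chains X Y f p q = chains X (p + q)"
  unfolding filt_chains_def chains_def
  by (intro arg_cong[of _ _ fun_vs.span] Collect_cong ex_cong1 conj_cong refl) (use assms in blast)

lemma simplex_dim_image_le:
  "finite \<sigma> \<Longrightarrow> simplex_dim (f ` \<sigma>) \<le> simplex_dim \<sigma>"
  using card_image_le[of \<sigma> f] by (simp add: simplex_dim_def)

lemma simplex_dim_le_complex_dim:
  assumes "simplicial_complex K" "finite_dimensional K" "\<sigma> \<in> K"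
  shows "simplex_dim \<sigma> \<le> complex_dim K"
proof -
  obtain d where d: "\<And>\<tau>. \<tau> \<in> K \<Longrightarrow> simplex_dim \<tau> \<le> d"
    using assms(2) by (auto simp: finite_dimensional_def)
  have "simplex_dim ` K \<subseteq> {-1..d}" using d by (auto simp: simplex_dim_def)
  then have "finite (simplex_dim ` K)" by (rule finite_subset) simp
  then show ?thesis using assms(3) by (auto simp: complex_dim_def)
qed

section \<open>The spectral sequence beyond the dimension of the base\<close>

theorem theorem2p7:
  fixes X :: "'v set set" and Y :: "'w set set" and f :: "'v \<Rightarrow> 'w" and m n :: int
  assumes "simplicial_complex X" and "simplicial_complex Y" and "simplicial_map X Y f"
    and "finite_dimensional Y" and "m = complex_dim Y"
    and "n \<ge> 0"
  shows "\<exists>\<phi> :: ('v list \<Rightarrow> 'k::field) set \<Rightarrow> int \<Rightarrow> ('v list \<Rightarrow> 'k) set.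
    vspace_iso (homology X n) (direct_sum {0..n} (\<lambda>p. leray_E X Y f (m + 1) p (n - p))) \<phi>
    \<and> canonical_on_filtration X Y f (m + 1) n \<phi>"
proof -
  \<comment> \<open>Indexing by the total degree \<open>d\<close> makes the filtration monotone in \<open>p\<close> alone.\<close>
  define C :: "int \<Rightarrow> int \<Rightarrow> ('v list \<Rightarrow> 'k) set" where "C d p = filt_chains X Y f p (d - p)" for d p
  let ?Z = "cycles X n :: ('v list \<Rightarrow> 'k) set" and ?B = "boundaries X n :: ('v list \<Rightarrow> 'k) set"
  define F where "F p = ?Z \<inter> C n p" for p
  define G D :: "int \<Rightarrow> ('v list \<Rightarrow> 'k) set"
    where "G p = leray_Z X Y f (m + 1) p (n - p)" and "D p = leray_D X Y f (m + 1) p (n - p)" for p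

  have C: "fun_vs.subspace (C d p)" for d p
    by (simp add: C_def subspace_filt_chains)
  have C_chains: "C d p \<subseteq> chains X d" for d p
    using filt_chains_subset_chains[of X Y f p "d - p"] by (simp add: C_def)
  have C_mono: "C d p \<subseteq> C d p'" if "p \<le> p'" for d p p'
    unfolding C_def using that by (intro filt_chains_mono) auto
  have C_neg: "C d p = {0}" if "p < 0" for d p
    using filt_chains_negative[OF assms(2) that] by (simp add: C_def)
  have C_dim: "C d p = chains X d" if "m \<le> p" for d p
  proof -
    have "f ` \<sigma> \<in> skeleton Y p" if "\<sigma> \<in> X" for \<sigma>
      using that assms(3,5) simplex_dim_le_complex_dim[OF assms(2,4), of "f ` \<sigma>"] \<open>m \<le> p\<close>
      by (auto simp: skeleton_def simplicial_map_def)
    then show ?thesis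
      using filt_chains_eq_chains[of X p "d - p" f Y] by (simp add: C_def)
  qed
  have C_top: "C d d = chains X d" for d
  proof -
    have "f ` \<sigma> \<in> skeleton Y d" if "\<sigma> \<in> X" "simplex_dim \<sigma> = d" for \<sigma>
    proof -
      have "finite \<sigma>" using assms(1) that(1) by (simp add: simplicial_complex_def)
      then have "simplex_dim (f ` \<sigma>) \<le> d" using simplex_dim_image_le[of \<sigma> f] that(2) by simp
      moreover have "f ` \<sigma> \<in> Y" using assms(3) that(1) by (simp add: simplicial_map_def)
      ultimately show ?thesis by (simp add: skeleton_def)
    qed
    then show ?thesis
      using filt_chains_eq_chains[of X d 0 f Y] by (simp add: C_def)
  qed

  have G_eq: "G p = C n p \<inter> boundary -` C (n - 1) (p - m - 1)" for p
    by (simp add: G_def leray_Z_def C_def algebra_simps)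
  have D_eq: "D p = (C n (p - 1) \<inter> boundary -` C (n - 1) (p - 1 - m))
      + (C n p \<inter> boundary ` C (n + 1) (p + m))" for p
    by (simp add: D_def leray_D_def leray_Z_def leray_B_def C_def algebra_simps)

  have B: "fun_vs.subspace ?B"
    unfolding boundaries_def by (rule subspace_boundary_image[OF subspace_chains order_refl])
  have Z: "fun_vs.subspace ?Z"
    unfolding cycles_vimage
    by (rule subspace_boundary_vimage[OF subspace_chains order_refl fun_vs.subspace_single_0])
  have F: "fun_vs.subspace (F p)" for p
    unfolding F_def using Z C by (rule fun_vs.subspace_inter)
  have D: "fun_vs.subspace (D p)" for p
    unfolding D_eq
    by (intro subspace_set_plus fun_vs.subspace_inter C subspace_boundary_vimage[OF C C_chains C]
        subspace_boundary_image[OF C C_chains])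
  have BZ: "?B \<subseteq> ?Z" by (rule boundaries_subset_cycles[OF assms(1)])
  have Fn: "F n = ?Z" by (auto simp: F_def C_top cycles_def)

  have D_pos: "D p = (C n (p - 1) \<inter> boundary -` C (n - 1) (p - 1 - m)) + (C n p \<inter> ?B)"
    if "p \<ge> 0" for p
    using that by (simp add: D_eq C_dim boundaries_def)
  have ker: "C n p \<inter> boundary -` {0} = F p" for p
    using C_chains[of n p] unfolding F_def cycles_def by blast
  \<comment> \<open>In these degrees the boundaries in question lie over a skeleton of negative dimension.\<close>
  have low: "G p = F p" "D p = F (p - 1) + C n p \<inter> ?B" if "0 \<le> p" "p \<le> m" for p
  proof -
    have "C (n - 1) (p - m - 1) = {0}" "C (n - 1) (p - 1 - m) = {0}"
      using that by (intro C_neg; simp)+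
    then show "G p = F p" "D p = F (p - 1) + C n p \<inter> ?B"
      using that by (simp_all only: G_eq D_pos ker)
  qed
  \<comment> \<open>In these degrees the skeleta of dimensions \<open>p - 1\<close> and \<open>p\<close> are both all of \<open>Y\<close>, so the numerator
    is already the first summand of the denominator.\<close>
  have high: "G p \<subseteq> D p" "F (p - 1) = F p" if "0 \<le> p" "m < p" for p
  proof -
    have Cp: "C n p = chains X n" "C n (p - 1) = chains X n"
      using that C_dim by auto
    then show "F (p - 1) = F p" by (simp add: F_def)
    have "G p = C n (p - 1) \<inter> boundary -` C (n - 1) (p - 1 - m)"
      unfolding G_eq Cp by (simp add: algebra_simps)
    also have "\<dots> \<subseteq> D p"
      unfolding D_pos[OF that(1)]
      by (intro subset_set_plus(1) fun_vs.subspace_inter B C subspace_boundary_vimage[OF C C_chains C])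
    finally show "G p \<subseteq> D p" .
  qed
  have FG: "F p \<subseteq> G p" for p
    using fun_vs.subspace_0[OF C] by (auto simp: F_def G_eq cycles_def)
  have GF: "G p \<subseteq> F p + D p" if "p \<in> {0..n}" for p
    using that low(1)[of p] high(1)[of p] subset_set_plus[OF F D, of p p] by (cases "p \<le> m") auto
  have FD: "F p \<inter> D p = F p \<inter> (F (p - 1) + ?B)" if "p \<in> {0..n}" for p
  proof (cases "p \<le> m")
    case True
    \<comment> \<open>Modular law for \<open>F (p - 1) \<subseteq> C n p\<close>.\<close>
    have D': "D p = F (p - 1) + C n p \<inter> ?B"
      using low(2) that True by simp
    have "x \<in> D p" if x: "x \<in> F p" "x \<in> F (p - 1) + ?B" for x
    proof -
      obtain a b where ab: "a \<in> F (p - 1)" "b \<in> ?B" "x = a + b"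
        using x(2) by (auto simp: set_plus_def)
      then have "b = x - a" by simp
      moreover have "x \<in> C n p" "a \<in> C n p"
        using x(1) ab(1) C_mono[of "p - 1" p n] by (auto simp: F_def)
      ultimately have "b \<in> C n p"
        using fun_vs.subspace_diff[OF C] by blast
      with ab show ?thesis unfolding D' by (blast intro: set_plus_intro)
    qed
    moreover have "D p \<subseteq> F (p - 1) + ?B"
      unfolding D' by (rule set_plus_mono2) auto
    ultimately show ?thesis by blast
  next
    case False
    then have "F p \<subseteq> D p" "F p \<subseteq> F (p - 1) + ?B"
      using high[of p] FG[of p] that subset_set_plus(1)[OF F B, of "p - 1"] by auto
    then show ?thesis by blast
  qed
  have mono: "F p \<subseteq> F q" if "p \<le> q" for p q
    using C_mono[OF that] by (auto simp: F_def)
  have bot: "F (-1) \<subseteq> ?B"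
    using fun_vs.subspace_0[OF B] by (auto simp: F_def C_neg)
  have "\<exists>\<phi>. vspace_iso (quotient_space (F n) ?B)
      (direct_sum {0..n} (\<lambda>p. quotient_space (G p) (D p))) \<phi>
    \<and> (\<forall>p\<in>{0..n}. \<forall>z\<in>F p. \<phi> (z +o ?B) p = z +o D p)"
    by (rule filtered_quotient_iso_graded[OF B F D mono bot assms(6) FG GF FD])
  then show ?thesis
    by (simp add: homology_def leray_E_def canonical_on_filtration_def Fn)
      (simp add: G_def D_def F_def C_def)
qed

end
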